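(* If $([\gamma_n])$ is a sequence in $\partial_\infty L_2^+$ with $m(\gamma_n)\to-\infty$, then $\mathfrak b^{\gamma_n}\to H$ in $\partial_h L_2$. Similarly, if $([\gamma_n])$ is a sequence in $\partial_\infty L_2^-$ with $M(\gamma_n)\to+\infty$, then $\mathfrak b^{\gamma_n}\to -H$ in $\partial_h L_2$.
   Context: Lamplighter group: $L_2=\langle a,t\mid a^2,\ [a^{t^i},a^{t^j}]\ \forall i,j\in\mathbb Z\rangle\cong(\bigoplus_{\mathbb Z}\mathbb Z/2)\rtimes\mathbb Z$. Each element is identified with a lamp stand: a finite set of lit lamps (positions in $\mathbb Z$) together with an integer position of the lamplighter. The identity $id$ has no lit lamps and lamplighter at $0$; right multiplication by $a$ toggles the lamp at the lamplighter's position; right multiplication by $t$ moves the lamplighter by $+1$. $H(g)$ is the lamplighter's position in $g$. $d$ is the word metric on $L_2$ with respect to $S=\{t,at\}$, i.e. $d(g,h)$ is the length of $g^{-1}h$ in $S\cup S^{-1}$. Horofunction boundary: $C(L_2)$ is the space of functions $L_2\to\mathbb R$ with the topology of uniform convergence on compact (i.e. finite) sets, so convergence is pointwise convergence; $i(z)(x)=d(z,x)-d(z,id)$ embeds $L_2$ in $C(L_2)$; $\overline{L_2}$ is the closure of $i(L_2)$ and $\partial_h L_2=\overline{L_2}\setminus i(L_2)$. A geodesic ray is an isometric embedding $\gamma:\mathbb N\to L_2$; two rays are asymptotic if $\sup_n d(\gamma(n),\gamma'(n))<\infty$; $\partial_\infty L_2^{\pm}$ is the set of asymptotic classes $[\gamma]$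 of geodesic rays with $\gamma(0)=id$ and $H(\gamma(n))\to\pm\infty$. The Busemann function is $\mathfrak b^\gamma(x)=\lim_{n\to\infty}\big(d(\gamma(n),x)-d(\gamma(n),id)\big)$, which depends only on $[\gamma]$. For such a ray each lamp's status in $\gamma(n)$ is eventually constant; the resulting (possibly infinite) configuration is the infinite lamp stand of $\gamma$, which depends only on $[\gamma]$. For $[\gamma]\in\partial_\infty L_2^+$, $m(\gamma)$ is the minimum position of a lit lamp in it ($+\infty$ if none); for $[\gamma]\in\partial_\infty L_2^-$, $M(\gamma)$ is the maximum position of a lit lamp in it ($-\infty$ if none). *)

theory Defs
  imports "HOL-Analysis.Analysis" "HOL-Algebra.Group" "HOL-Library.FSet"
begin

datatype lampstand = Lampstand (lit: "int fset") (H: int)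

text \<open>
  The group law is that of the semidirect product of the direct sum of copies of
  \<open>\<int>/2\<close> over \<open>\<int>\<close> with \<open>\<int>\<close>: configurations add modulo 2 (symmetric difference), after
  the second one has been shifted by the lamplighter's position in the first.
\<close>

definition lamp_mult :: "lampstand \<Rightarrow> lampstand \<Rightarrow> lampstand" where
  "lamp_mult g h =
     (let B = (\<lambda>p. H g + p) |`| lit h
      in Lampstand ((lit g |-| B) |\<union>| (B |-| lit g)) (H g + H h))"

definition L2 :: "lampstand monoid" where
  "L2 = \<lparr>carrier = UNIV, mult = lamp_mult, one = Lampstand {||} 0\<rparr>"

definition gen_a :: lampstand where
  "gen_a = Lampstand {|0|} 0"

definition gen_t :: lampstand where
  "gen_t = Lampstand {||} 1"

lemma L2_group: "group L2"
proof (rule groupI)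
  fix x y z
  show "x \<otimes>\<^bsub>L2\<^esub> y \<otimes>\<^bsub>L2\<^esub> z = x \<otimes>\<^bsub>L2\<^esub> (y \<otimes>\<^bsub>L2\<^esub> z)"
    by (cases x; cases y; cases z)
       (auto simp: L2_def lamp_mult_def Let_def fset_eq_iff image_iff add.assoc)
next
  fix x
  show "\<exists>y\<in>carrier L2. y \<otimes>\<^bsub>L2\<^esub> x = \<one>\<^bsub>L2\<^esub>"
    by (intro bexI[of _ "Lampstand ((\<lambda>p. p - H x) |`| lit x) (- H x)"])
       (auto simp: L2_def lamp_mult_def Let_def fset_eq_iff image_iff)
qed (auto simp: L2_def lamp_mult_def fset_eq_iff image_iff)

lemma right_mult_gen_a:
  "g \<otimes>\<^bsub>L2\<^esub> gen_a =
     Lampstand (if H g |\<in>| lit g then lit g |-| {|H g|} else finsert (H g) (lit g)) (H g)"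
  by (auto simp: L2_def lamp_mult_def gen_a_def fset_eq_iff)

lemma right_mult_gen_t: "g \<otimes>\<^bsub>L2\<^esub> gen_t = Lampstand (lit g) (H g + 1)"
  by (auto simp: L2_def lamp_mult_def gen_t_def fset_eq_iff)

definition S :: "lampstand set" where
  "S = {gen_t, gen_a \<otimes>\<^bsub>L2\<^esub> gen_t}"

definition word_length :: "lampstand \<Rightarrow> nat" where
  "word_length g = (LEAST n. \<exists>ws. length ws = n \<and> set ws \<subseteq> S \<union> m_inv L2 ` S \<and>
                                  foldr (mult L2) ws \<one>\<^bsub>L2\<^esub> = g)"

definition d :: "lampstand \<Rightarrow> lampstand \<Rightarrow> real" where
  "d g h = real (word_length (inv\<^bsub>L2\<^esub> g \<otimes>\<^bsub>L2\<^esub> h))"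

text \<open>
  The topology on \<open>lampstand \<Rightarrow> real\<close> is the library's product topology. The group is
  discrete, so this is the topology of uniform convergence on compact sets and all
  functions are continuous.
\<close>

definition horo_embed :: "lampstand \<Rightarrow> lampstand \<Rightarrow> real" where
  "horo_embed z x = d z x - d z \<one>\<^bsub>L2\<^esub>"

definition horofunction_boundary :: "(lampstand \<Rightarrow> real) set" where
  "horofunction_boundary = closure (range horo_embed) - range horo_embed"

definition geodesic_ray :: "(nat \<Rightarrow> lampstand) \<Rightarrow> bool" where
  "geodesic_ray \<gamma> \<longleftrightarrow> (\<forall>i j. d (\<gamma> i) (\<gamma> j) = \<bar>real i - real j\<bar>)"

definition asymptotic :: "(nat \<Rightarrow> lampstand) \<Rightarrow> (nat \<Rightarrow> lampstand) \<Rightarrow> bool" where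
  "asymptotic \<gamma> \<gamma>' \<longleftrightarrow> bdd_above (range (\<lambda>n. d (\<gamma> n) (\<gamma>' n)))"

definition rays_plus :: "(nat \<Rightarrow> lampstand) set" where
  "rays_plus = {\<gamma>. geodesic_ray \<gamma> \<and> \<gamma> 0 = \<one>\<^bsub>L2\<^esub> \<and>
                   filterlim (\<lambda>n. H (\<gamma> n)) at_top sequentially}"

definition rays_minus :: "(nat \<Rightarrow> lampstand) set" where
  "rays_minus = {\<gamma>. geodesic_ray \<gamma> \<and> \<gamma> 0 = \<one>\<^bsub>L2\<^esub> \<and>
                    filterlim (\<lambda>n. H (\<gamma> n)) at_bot sequentially}"

definition boundary_plus :: "(nat \<Rightarrow> lampstand) set set" where
  "boundary_plus = rays_plus // {(\<gamma>, \<gamma>') \<in> rays_plus \<times> rays_plus. asymptotic \<gamma> \<gamma>'}"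

definition boundary_minus :: "(nat \<Rightarrow> lampstand) set set" where
  "boundary_minus = rays_minus // {(\<gamma>, \<gamma>') \<in> rays_minus \<times> rays_minus. asymptotic \<gamma> \<gamma>'}"

definition busemann :: "(nat \<Rightarrow> lampstand) \<Rightarrow> lampstand \<Rightarrow> real" where
  "busemann \<gamma> x = lim (\<lambda>n. d (\<gamma> n) x - d (\<gamma> n) \<one>\<^bsub>L2\<^esub>)"

definition limit_lit :: "(nat \<Rightarrow> lampstand) \<Rightarrow> int set" where
  "limit_lit \<gamma> = {p. eventually (\<lambda>n. p |\<in>| lit (\<gamma> n)) sequentially}"

text \<open>
  A ray in \<open>rays_plus\<close> visits only finitely many negative positions, so a nonempty
  \<open>limit_lit\<close> has a least element; dually for \<open>rays_minus\<close>.
\<close>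

definition min_lit :: "(nat \<Rightarrow> lampstand) \<Rightarrow> ereal" where
  "min_lit \<gamma> = (if limit_lit \<gamma> = {} then \<infinity>
                else ereal (real_of_int (LEAST p. p \<in> limit_lit \<gamma>)))"

definition max_lit :: "(nat \<Rightarrow> lampstand) \<Rightarrow> ereal" where
  "max_lit \<gamma> = (if limit_lit \<gamma> = {} then - \<infinity>
                else ereal (real_of_int (GREATEST p. p \<in> limit_lit \<gamma>)))"

end

theory Submission
  imports Defs
begin

text \<open>
  Crossing the edge between \<open>k\<close> and \<open>k + 1\<close> in either direction is exactly what allows the
  lamp at \<open>k\<close> to be toggled. Hence \<open>d g x\<close> is the minimum of \<open>2 (r - l) - \<bar>H g - H x\<bar>\<close>
  over the intervals \<open>[l, r]\<close> that contain both lamplighter positions and all edges whose lamps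
  differ. If \<open>H (\<gamma> N)\<close> lies far to the right of everything in \<open>x\<close>, and \<open>\<gamma> N\<close> has a lit
  lamp to the left of everything in \<open>x\<close>, then the admissible intervals for \<open>(\<gamma> N, x)\<close> and
  \<open>(\<gamma> N, id)\<close> coincide, so that \<open>d (\<gamma> N) x - d (\<gamma> N) id = H x\<close>.
  A Busemann function takes the value \<open>- k\<close> at \<open>\<gamma> k\<close>, whereas every \<open>horo_embed z\<close> is
  bounded below; this separates Busemann functions, and likewise \<open>H\<close> and \<open>- H\<close>, from the
  image of the group.
\<close>

section \<open>The word metric\<close>

lemma H_mult [simp]: "H (g \<otimes>\<^bsub>L2\<^esub> h) = H g + H h"
  by (simp add: L2_def lamp_mult_def Let_def)

lemma lit_mult [simp]:
  "p |\<in>| lit (g \<otimes>\<^bsub>L2\<^esub> h) \<longleftrightarrow> (p |\<in>| lit g) \<noteq> (p - H g |\<in>| lit h)"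
  by (force simp: L2_def lamp_mult_def Let_def image_iff)

lemma one_L2: "\<one>\<^bsub>L2\<^esub> = Lampstand {||} 0"
  by (simp add: L2_def)

lemma carrier_L2 [simp]: "g \<in> carrier L2"
  by (simp add: L2_def)

lemma lampstand_eqI:
  "H g = H h \<Longrightarrow> (\<And>p. p |\<in>| lit g \<longleftrightarrow> p |\<in>| lit h) \<Longrightarrow> g = h"
  by (cases g; cases h) (auto simp: fset_eq_iff)

lemma inv_L2: "inv\<^bsub>L2\<^esub> g = Lampstand ((\<lambda>p. p - H g) |`| lit g) (- H g)"
  by (rule group.inv_equality[OF L2_group])
     (auto intro!: lampstand_eqI simp: one_L2 image_iff, metis add_diff_cancel_right')

definition gens :: "lampstand set" where
  "gens = S \<union> m_inv L2 ` S"

text \<open>The inverse of \<open>at\<close> moves left first and toggles afterwards, so its lamp is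
  at -1. All four generators thus act only on the lamp at the left end of the edge crossed.\<close>

lemma gens_eq:
  "gens = {Lampstand {||} 1, Lampstand {|0|} 1, Lampstand {||} (-1), Lampstand {|-1|} (-1)}"
proof -
  have at: "gen_a \<otimes>\<^bsub>L2\<^esub> gen_t = Lampstand {|0|} 1"
    by (rule lampstand_eqI) (auto simp: gen_a_def gen_t_def)
  show ?thesis
    unfolding gens_def S_def at by (auto simp: gen_t_def inv_L2)
qed

lemma inv_gens: "s \<in> gens \<Longrightarrow> inv\<^bsub>L2\<^esub> s \<in> gens"
  by (auto simp: gens_eq inv_L2)

definition word :: "lampstand list \<Rightarrow> lampstand" where
  "word ws = foldr (mult L2) ws \<one>\<^bsub>L2\<^esub>"

lemma word_Nil: "word [] = \<one>\<^bsub>L2\<^esub>"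
  by (simp add: word_def)

lemma word_snoc: "word (ws @ [s]) = word ws \<otimes>\<^bsub>L2\<^esub> s"
proof -
  interpret group L2 by (rule L2_group)
  show ?thesis
    unfolding word_def by (induction ws) (auto simp: m_assoc)
qed

lemma word_length_word: "word_length g = (LEAST n. \<exists>ws. length ws = n \<and> set ws \<subseteq> gens \<and> word ws = g)"
  by (simp add: word_length_def gens_def word_def)

section \<open>Word length as the cost of an optimal interval\<close>

text \<open>Lamp \<open>p\<close> belongs to the edge from \<open>p\<close> to \<open>p + 1\<close>,
  hence the strict bound on the right only. The shortest walk from 0 to \<open>H g\<close> through
  both ends of the interval has length \<open>2 * (r - l) - \<bar>H g\<bar>\<close>, called its cost
  below.\<close>

definition spans :: "int \<Rightarrow> int \<Rightarrow> lampstand \<Rightarrow> bool" where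
  "spans l r g \<longleftrightarrow> l \<le> 0 \<and> 0 \<le> r \<and> l \<le> H g \<and> H g \<le> r \<and> (\<forall>p. p |\<in>| lit g \<longrightarrow> l \<le> p \<and> p < r)"

lemma spansD:
  assumes "spans l r g"
  shows "l \<le> 0" "0 \<le> r" "l \<le> H g" "H g \<le> r"
  using assms by (auto simp: spans_def)

text \<open>A step inside the interval changes only \<open>\<bar>H g\<bar>\<close>, by one. A step
  out of it starts at an end, on that end's side of 0, so the 2 paid for the longer interval is
  offset by the growth of \<open>\<bar>H g\<bar>\<close>.\<close>

lemma spans_mult_gen:
  assumes "spans l r g" "s \<in> gens"
  shows "\<exists>l' r'. spans l' r' (g \<otimes>\<^bsub>L2\<^esub> s) \<and>
           2 * (r' - l') - \<bar>H (g \<otimes>\<^bsub>L2\<^esub> s)\<bar> \<le> 2 * (r - l) - \<bar>H g\<bar> + 1"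
proof (intro exI conjI)
  let ?l = "min l (H (g \<otimes>\<^bsub>L2\<^esub> s))" and ?r = "max r (H (g \<otimes>\<^bsub>L2\<^esub> s))"
  show "spans ?l ?r (g \<otimes>\<^bsub>L2\<^esub> s)"
    using assms unfolding spans_def gens_eq by (auto; fastforce)
  show "2 * (?r - ?l) - \<bar>H (g \<otimes>\<^bsub>L2\<^esub> s)\<bar> \<le> 2 * (r - l) - \<bar>H g\<bar> + 1"
  proof -
    have "H s = 1 \<or> H s = - 1"
      using assms(2) by (auto simp: gens_eq)
    then show ?thesis
      using spansD[OF assms(1)] by (elim disjE) (simp_all add: max_def min_def abs_if)
  qed
qed

lemma spans_word:
  assumes "set ws \<subseteq> gens"
  shows "\<exists>l r. spans l r (word ws) \<and> 2 * (r - l) - \<bar>H (word ws)\<bar> \<le> int (length ws)"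
  using assms
proof (induction ws rule: rev_induct)
  case Nil
  show ?case
    by (intro exI[of _ 0]) (simp add: word_Nil spans_def one_L2)
next
  case (snoc s ws)
  then obtain l r where "spans l r (word ws)" and
    le: "2 * (r - l) - \<bar>H (word ws)\<bar> \<le> int (length ws)"
    by auto
  moreover have "s \<in> gens"
    using snoc.prems by simp
  ultimately obtain l' r' where "spans l' r' (word ws \<otimes>\<^bsub>L2\<^esub> s)"
    "2 * (r' - l') - \<bar>H (word ws \<otimes>\<^bsub>L2\<^esub> s)\<bar> \<le> 2 * (r - l) - \<bar>H (word ws)\<bar> + 1"
    using spans_mult_gen by blast
  with le show ?case
    by (intro exI[of _ l'] exI[of _ r']) (auto simp: word_snoc)
qed

text \<open>Retraces a shortest walk from its end: move outward until the end of the interval on the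
  side of \<open>H g\<close> is reached, then turn back, switching off lamps and shrinking the
  interval. For \<open>H g = 0\<close> the right end is served first.\<close>

lemma spans_descend:
  assumes "spans l r g" "2 * (r - l) - \<bar>H g\<bar> = int (Suc n)"
  shows "\<exists>s\<in>gens. \<exists>l' r'. spans l' r' (g \<otimes>\<^bsub>L2\<^esub> s) \<and>
           2 * (r' - l') - \<bar>H (g \<otimes>\<^bsub>L2\<^esub> s)\<bar> = int n"
proof -
  define right where "right = Lampstand {||} 1"
  \<comment> \<open>The primed moves choose the generator that leaves the lamp on the crossed edge
    off.\<close>
  define right' where "right' = (if H g |\<in>| lit g then Lampstand {|0|} 1 else right)"
  define left where "left = Lampstand {||} (-1)"
  define left' where "left' = (if H g - 1 |\<in>| lit g then Lampstand {|-1|} (-1) else left)"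
  have gens: "right \<in> gens" "right' \<in> gens" "left \<in> gens" "left' \<in> gens"
    by (auto simp: gens_eq right_def right'_def left_def left'_def)
  consider "0 \<le> H g" "H g < r" | "0 < H g" "H g = r" | "H g = 0" "r = 0"
    | "H g < 0" "l < H g" | "H g < 0" "l = H g"
    using assms(1) unfolding spans_def by force
  then show ?thesis
  proof cases
    case 1
    then have "spans l r (g \<otimes>\<^bsub>L2\<^esub> right)" 
      using assms(1) by (auto simp: spans_def right_def)
    with 1 assms(2) gens(1) show ?thesis
      by (intro bexI[of _ right] exI[of _ l] exI[of _ r]) (auto simp: right_def)
  next
    case 2
    have "p |\<in>| lit g \<and> p \<noteq> H g - 1" if "p |\<in>| lit (g \<otimes>\<^bsub>L2\<^esub> left')" for p
      using that by (cases "p = H g - 1") (auto simp: left'_def left_def split: if_splits)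
    then have "l \<le> p \<and> p < r - 1" if "p |\<in>| lit (g \<otimes>\<^bsub>L2\<^esub> left')" for p
      using that assms(1) 2 unfolding spans_def by force
    then have "spans l (r - 1) (g \<otimes>\<^bsub>L2\<^esub> left')"
      using assms(1) 2 unfolding spans_def by (simp add: left'_def left_def)
    with 2 assms(2) gens(4) show ?thesis
      by (intro bexI[of _ left'] exI[of _ l] exI[of _ "r - 1"]) (auto simp: left'_def left_def)
  next
    case 3
    \<comment> \<open>The positive cost forces \<open>l < 0\<close>, so there is room on the
      left.\<close>
    then have "spans l r (g \<otimes>\<^bsub>L2\<^esub> left)"
      using assms by (auto simp: spans_def left_def)
    with 3 assms(2) gens(3) show ?thesis
      by (intro bexI[of _ left] exI[of _ l] exI[of _ r]) (auto simp: left_def)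
  next
    case 4
    then have "spans l r (g \<otimes>\<^bsub>L2\<^esub> left)"
      using assms by (auto simp: spans_def left_def)
    with 4 assms(2) gens(3) show ?thesis
      by (intro bexI[of _ left] exI[of _ l] exI[of _ r]) (auto simp: left_def)
  next
    case 5
    have "p |\<in>| lit g \<and> p \<noteq> H g" if "p |\<in>| lit (g \<otimes>\<^bsub>L2\<^esub> right')" for p
      using that by (cases "p = H g") (auto simp: right'_def right_def split: if_splits)
    then have "l + 1 \<le> p \<and> p < r" if "p |\<in>| lit (g \<otimes>\<^bsub>L2\<^esub> right')" for p
      using that assms(1) 5 unfolding spans_def by force
    then have "spans (l + 1) r (g \<otimes>\<^bsub>L2\<^esub> right')"
      using assms(1) 5 unfolding spans_def by (simp add: right'_def right_def)
    with 5 assms(2) gens(2) show ?thesis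
      by (intro bexI[of _ right'] exI[of _ "l + 1"] exI[of _ r]) (auto simp: right'_def right_def)
  qed
qed

text \<open>Induction on the cost: descend by a generator \<open>s\<close>, spell the cheaper
  element, and append the inverse of \<open>s\<close>.\<close>

lemma word_of_spans:
  assumes "spans l r g" "2 * (r - l) - \<bar>H g\<bar> = int n"
  shows "\<exists>ws. length ws = n \<and> set ws \<subseteq> gens \<and> word ws = g"
  using assms
proof (induction n arbitrary: l r g)
  case 0
  \<comment> \<open>Since 0 and \<open>H g\<close> both lie in the interval,
    \<open>\<bar>H g\<bar> \<le> r - l\<close>; zero cost then collapses it.\<close>
  then have "l = 0 \<and> r = 0 \<and> H g = 0"
    using spansD[OF 0(1)] by (simp add: abs_if split: if_splits)
  with 0 have "g = \<one>\<^bsub>L2\<^esub>"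
    by (intro lampstand_eqI) (force simp: spans_def one_L2)+
  then show ?case
    by (simp add: word_Nil)
next
  case (Suc n)
  interpret group L2 by (rule L2_group)
  from spans_descend[OF Suc.prems] Suc.IH obtain s ws where
    s: "s \<in> gens" and ws: "length ws = n" "set ws \<subseteq> gens" "word ws = g \<otimes>\<^bsub>L2\<^esub> s"
    by metis
  have "word (ws @ [inv\<^bsub>L2\<^esub> s]) = g"
    by (simp add: word_snoc ws m_assoc)
  with ws s inv_gens show ?case
    by (intro exI[of _ "ws @ [inv\<^bsub>L2\<^esub> s]"]) auto
qed

lemma word_length_le_spans:
  assumes "spans l r g"
  shows "int (word_length g) \<le> 2 * (r - l) - \<bar>H g\<bar>"
proof -
  define n where "n = nat (2 * (r - l) - \<bar>H g\<bar>)"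
  have n: "2 * (r - l) - \<bar>H g\<bar> = int n"
    using assms by (auto simp: n_def spans_def)
  show ?thesis
    unfolding n word_length_word of_nat_le_iff
    by (rule Least_le, rule word_of_spans[OF assms n])
qed

lemma spans_exists: "\<exists>l r. spans l r g"
proof -
  obtain b where b: "\<And>p. p \<in> fset (lit g) \<Longrightarrow> \<bar>p\<bar> \<le> b"
    using finite_fset[of "lit g"] by (metis bdd_above.E bdd_above_finite finite_imageI imageI)
  show ?thesis
    using b
    by (intro exI[of _ "- max \<bar>b\<bar> \<bar>H g\<bar>"] exI[of _ "max \<bar>b\<bar> \<bar>H g\<bar> + 1"]) (fastforce simp: spans_def)
qed

text \<open>A shortest word yields an interval of cost at most its length by
  \<open>spans_word\<close>, and no interval costs less by
  \<open>word_length_le_spans\<close>.\<close>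

lemma word_length_attained:
  "\<exists>l r. spans l r g \<and> int (word_length g) = 2 * (r - l) - \<bar>H g\<bar>"
proof -
  obtain l r where lr: "spans l r g"
    using spans_exists by blast
  then have "0 \<le> 2 * (r - l) - \<bar>H g\<bar>"
    using spansD[OF lr] by (simp add: abs_if)
  with lr have "\<exists>n ws. length ws = n \<and> set ws \<subseteq> gens \<and> word ws = g"
    using word_of_spans zero_le_imp_eq_int by metis
  then have "\<exists>ws. length ws = word_length g \<and> set ws \<subseteq> gens \<and> word ws = g"
    unfolding word_length_word by (rule LeastI_ex)
  with spans_word obtain l r where
    "spans l r g" "2 * (r - l) - \<bar>H g\<bar> \<le> int (word_length g)"
    by metis
  with word_length_le_spans show ?thesis
    by (metis order_antisym)
qed

section \<open>Distance between two lamp stands\<close>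

definition connects :: "int \<Rightarrow> int \<Rightarrow> lampstand \<Rightarrow> lampstand \<Rightarrow> bool" where
  "connects l r g x \<longleftrightarrow> l \<le> H g \<and> H g \<le> r \<and> l \<le> H x \<and> H x \<le> r \<and>
     (\<forall>p. (p |\<in>| lit g) \<noteq> (p |\<in>| lit x) \<longrightarrow> l \<le> p \<and> p < r)"

lemma connectsD:
  assumes "connects l r g x"
  shows "l \<le> H g" "H g \<le> r" "l \<le> H x" "H x \<le> r"
  using assms by (auto simp: connects_def)

text \<open>Translating by \<open>g\<close> carries position 0 to \<open>H g\<close>, and the lit
  lamps of the quotient to the lamps on which \<open>g\<close> and \<open>x\<close> differ.\<close>

lemma spans_inv_mult:
  "spans l r (inv\<^bsub>L2\<^esub> g \<otimes>\<^bsub>L2\<^esub> x) \<longleftrightarrow> connects (H g + l) (H g + r) g x"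
proof -
  have lit: "p |\<in>| lit (inv\<^bsub>L2\<^esub> g \<otimes>\<^bsub>L2\<^esub> x) \<longleftrightarrow>
      (H g + p |\<in>| lit g) \<noteq> (H g + p |\<in>| lit x)" for p
    by (force simp: inv_L2 image_iff algebra_simps)
  have shift: "(\<forall>p. Q (H g + p) \<longrightarrow> l \<le> p \<and> p < r) \<longleftrightarrow>
      (\<forall>p. Q p \<longrightarrow> H g + l \<le> p \<and> p < H g + r)" for Q
  proof
    assume Q: "\<forall>p. Q (H g + p) \<longrightarrow> l \<le> p \<and> p < r"
    have "H g + l \<le> p \<and> p < H g + r" if "Q p" for p
      using Q[rule_format, of "p - H g"] that by auto
    then show "\<forall>p. Q p \<longrightarrow> H g + l \<le> p \<and> p < H g + r"
      by blast
  qed auto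
  have "H (inv\<^bsub>L2\<^esub> g \<otimes>\<^bsub>L2\<^esub> x) = H x - H g"
    by (simp add: inv_L2)
  then show ?thesis
    unfolding spans_def connects_def lit
      shift[of "\<lambda>p. (p |\<in>| lit g) \<noteq> (p |\<in>| lit x)"]
    by auto
qed

lemma d_le_connects:
  assumes "connects l r g x"
  shows "d g x \<le> real_of_int (2 * (r - l) - \<bar>H g - H x\<bar>)"
proof -
  have "spans (l - H g) (r - H g) (inv\<^bsub>L2\<^esub> g \<otimes>\<^bsub>L2\<^esub> x)"
    using assms by (simp add: spans_inv_mult)
  from word_length_le_spans[OF this] show ?thesis
    unfolding d_def by (simp add: inv_L2 abs_minus_commute)
qed

lemma d_attained:
  "\<exists>l r. connects l r g x \<and> d g x = real_of_int (2 * (r - l) - \<bar>H g - H x\<bar>)"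
proof -
  obtain l r where lr: "spans l r (inv\<^bsub>L2\<^esub> g \<otimes>\<^bsub>L2\<^esub> x)"
    "int (word_length (inv\<^bsub>L2\<^esub> g \<otimes>\<^bsub>L2\<^esub> x)) = 2 * (r - l) - \<bar>H (inv\<^bsub>L2\<^esub> g \<otimes>\<^bsub>L2\<^esub> x)\<bar>"
    using word_length_attained by blast
  have "d g x = real_of_int (int (word_length (inv\<^bsub>L2\<^esub> g \<otimes>\<^bsub>L2\<^esub> x)))"
    by (simp add: d_def)
  then have "d g x = real_of_int (2 * (r - l) - \<bar>H g - H x\<bar>)"
    unfolding lr(2) by (simp add: inv_L2 abs_minus_commute)
  with lr(1) show ?thesis
    unfolding spans_inv_mult
    by (intro exI[of _ "H g + l"] exI[of _ "H g + r"]) simp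
qed

text \<open>A lamp that differs between \<open>g\<close> and \<open>y\<close> differs across one of
  the two legs, so the hull of optimal intervals for the legs is admissible for the pair.\<close>

lemma d_triangle: "d g y \<le> d g x + d x y"
proof -
  obtain l r where c1: "connects l r g x"
    and eq1: "d g x = real_of_int (2 * (r - l) - \<bar>H g - H x\<bar>)"
    using d_attained by blast
  obtain l' r' where c2: "connects l' r' x y"
    and eq2: "d x y = real_of_int (2 * (r' - l') - \<bar>H x - H y\<bar>)"
    using d_attained by blast
  have "min l l' \<le> p \<and> p < max r r'" if "(p |\<in>| lit g) \<noteq> (p |\<in>| lit y)" for p
  proof (cases "(p |\<in>| lit g) = (p |\<in>| lit x)")
    case True
    with that c2 have "l' \<le> p \<and> p < r'"
      by (auto simp: connects_def)
    then show ?thesis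
      by linarith
  next
    case False
    with c1 have "l \<le> p \<and> p < r"
      by (auto simp: connects_def)
    then show ?thesis
      by linarith
  qed
  with c1 c2 have "connects (min l l') (max r r') g y"
    unfolding connects_def by (simp add: min_le_iff_disj le_max_iff_disj)
  then have "d g y \<le> real_of_int (2 * (max r r' - min l l') - \<bar>H g - H y\<bar>)"
    by (rule d_le_connects)
  \<comment> \<open>Both intervals contain \<open>H x\<close>, so the hull saves the length of their
    intersection. That contains the overlap of the segments from \<open>H g\<close> to
    \<open>H x\<close> and from \<open>H x\<close> to \<open>H y\<close>, whose double is the defect
    in the triangle inequality for the positions.\<close>
  also have "2 * (max r r' - min l l') - \<bar>H g - H y\<bar> \<le>
      2 * (r - l) - \<bar>H g - H x\<bar> + (2 * (r' - l') - \<bar>H x - H y\<bar>)"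
    using connectsD[OF c1] connectsD[OF c2] by (smt (verit))
  finally show ?thesis
    using eq1 eq2 by simp
qed

text \<open>Both minima range over the same intervals, so the terms in \<open>r - l\<close> cancel
  and only the position terms remain.\<close>

lemma d_diff_eq:
  assumes "\<And>l r. connects l r g x \<longleftrightarrow> connects l r g y"
  shows "d g x - d g y = real_of_int (\<bar>H g - H y\<bar> - \<bar>H g - H x\<bar>)"
proof -
  obtain l r where c1: "connects l r g x"
    and "d g x = real_of_int (2 * (r - l) - \<bar>H g - H x\<bar>)"
    using d_attained by blast
  moreover obtain l' r' where c2: "connects l' r' g y"
    and "d g y = real_of_int (2 * (r' - l') - \<bar>H g - H y\<bar>)"
    using d_attained by blast
  moreover have "d g x \<le> real_of_int (2 * (r' - l') - \<bar>H g - H x\<bar>)"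
    using c2 assms by (blast intro: d_le_connects)
  moreover have "d g y \<le> real_of_int (2 * (r - l) - \<bar>H g - H y\<bar>)"
    using c1 assms by (blast intro: d_le_connects)
  ultimately show ?thesis
    by simp
qed

section \<open>Busemann functions and the boundary\<close>

lemma horo_embed_bounded_below: "- d z \<one>\<^bsub>L2\<^esub> \<le> horo_embed z x"
  by (simp add: horo_embed_def d_def)

lemma not_horo_embed:
  assumes "\<And>k :: nat. \<exists>x. f x \<le> - real k"
  shows "f \<notin> range horo_embed"
proof
  assume "f \<in> range horo_embed"
  then obtain z where z: "f = horo_embed z"
    by blast
  obtain k where "d z \<one>\<^bsub>L2\<^esub> < real k"
    using reals_Archimedean2 by blast
  moreover obtain x where "f x \<le> - real k"
    using assms by blast
  ultimately show False
    using horo_embed_bounded_below[of z x] by (simp add: z)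
qed

lemma tendsto_fun_pointwise:
  fixes f :: "nat \<Rightarrow> 'a \<Rightarrow> real"
  assumes "\<And>x. (\<lambda>n. f n x) \<longlonglongrightarrow> g x"
  shows "f \<longlonglongrightarrow> g"
proof -
  have "limitin (product_topology (\<lambda>_. euclidean) UNIV) f g sequentially"
    unfolding limitin_componentwise using assms by (auto simp: extensional_def)
  then show ?thesis
    by (simp add: euclidean_product_topology)
qed

lemma busemann_LIMSEQ:
  assumes "geodesic_ray \<gamma>" "\<gamma> 0 = \<one>\<^bsub>L2\<^esub>"
  shows "(\<lambda>n. horo_embed (\<gamma> n) x) \<longlonglongrightarrow> busemann \<gamma> x"
proof -
  have dist: "d (\<gamma> i) (\<gamma> j) = \<bar>real i - real j\<bar>" for i j
    using assms by (simp add: geodesic_ray_def)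
  have n: "d (\<gamma> n) \<one>\<^bsub>L2\<^esub> = real n" for n
    using dist[of n 0] assms(2) by simp
  have "decseq (\<lambda>n. horo_embed (\<gamma> n) x)"
    unfolding decseq_Suc_iff
  proof
    fix n
    have "d (\<gamma> (Suc n)) x \<le> 1 + d (\<gamma> n) x"
      using d_triangle[of "\<gamma> (Suc n)" x "\<gamma> n"] dist[of "Suc n" n] by simp
    then show "horo_embed (\<gamma> (Suc n)) x \<le> horo_embed (\<gamma> n) x"
      by (simp add: horo_embed_def n)
  qed
  moreover have "- d x \<one>\<^bsub>L2\<^esub> \<le> horo_embed (\<gamma> n) x" for n
    using d_triangle[of "\<gamma> n" "\<one>\<^bsub>L2\<^esub>" x] by (simp add: horo_embed_def)
  ultimately obtain L where "(\<lambda>n. horo_embed (\<gamma> n) x) \<longlonglongrightarrow> L"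
    using decseq_convergent by blast
  then show ?thesis
    unfolding busemann_def horo_embed_def by (metis limI)
qed

lemma busemann_ray:
  assumes "geodesic_ray \<gamma>" "\<gamma> 0 = \<one>\<^bsub>L2\<^esub>"
  shows "busemann \<gamma> (\<gamma> k) = - real k"
proof -
  have dist: "d (\<gamma> i) (\<gamma> j) = \<bar>real i - real j\<bar>" for i j
    using assms by (simp add: geodesic_ray_def)
  have "horo_embed (\<gamma> n) (\<gamma> k) = - real k" if "n \<ge> k" for n
    using that dist[of n k] dist[of n 0] assms(2) by (simp add: horo_embed_def)
  then have "(\<lambda>n. horo_embed (\<gamma> n) (\<gamma> k)) \<longlonglongrightarrow> - real k"
    by (intro tendsto_eventually) (auto simp: eventually_sequentially)
  then show ?thesis
    using busemann_LIMSEQ[OF assms] LIMSEQ_unique by blast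
qed

lemma busemann_in_horofunction_boundary:
  assumes "geodesic_ray \<gamma>" "\<gamma> 0 = \<one>\<^bsub>L2\<^esub>"
  shows "busemann \<gamma> \<in> horofunction_boundary"
proof -
  have lim: "(\<lambda>n. horo_embed (\<gamma> n)) \<longlonglongrightarrow> busemann \<gamma>"
    by (intro tendsto_fun_pointwise busemann_LIMSEQ assms)
  have "busemann \<gamma> \<in> closure (range horo_embed)"
    by (rule closed_sequentially[OF closed_closure _ lim]) (meson closure_subset rangeI subsetD)
  moreover have "busemann \<gamma> \<notin> range horo_embed"
    by (rule not_horo_embed) (metis busemann_ray[OF assms] order_refl)
  ultimately show ?thesis
    by (simp add: horofunction_boundary_def)
qed

text \<open>Convergence in the subspace also demands that the limit lie in it: closure holds as a
  limit of boundary points, and unboundedness below keeps \<open>f\<close> out of the image of the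
  group.\<close>

lemma limitin_horofunction_boundary:
  assumes "\<And>n. b n \<in> horofunction_boundary"
    and "\<And>x. eventually (\<lambda>n. b n x = f x) sequentially"
    and "\<And>k :: nat. \<exists>x. f x \<le> - real k"
  shows "limitin (top_of_set horofunction_boundary) b f sequentially"
proof -
  have lim: "b \<longlonglongrightarrow> f"
    by (intro tendsto_fun_pointwise tendsto_eventually assms(2))
  have "f \<in> closure (range horo_embed)"
    using assms(1) by (intro closed_sequentially[OF closed_closure _ lim])
      (auto simp: horofunction_boundary_def)
  with not_horo_embed[OF assms(3)] have "f \<in> horofunction_boundary"
    by (simp add: horofunction_boundary_def)
  with lim assms(1) show ?thesis
    by (simp add: limitin_subtopology)
qed

lemma busemann_eqI:
  assumes "geodesic_ray \<gamma>" "\<gamma> 0 = \<one>\<^bsub>L2\<^esub>"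
    and "eventually (\<lambda>N. horo_embed (\<gamma> N) x = c) sequentially"
  shows "busemann \<gamma> x = c"
  using busemann_LIMSEQ[OF assms(1,2)] tendsto_eventually[OF assms(3)] LIMSEQ_unique by blast

section \<open>Values of Busemann functions near a distant lit lamp\<close>

lemma busemann_eq_H:
  assumes "\<gamma> \<in> rays_plus" "spans l r x" "p \<in> limit_lit \<gamma>" "p < l"
  shows "busemann \<gamma> x = real_of_int (H x)"
proof (rule busemann_eqI)
  show "geodesic_ray \<gamma>" "\<gamma> 0 = \<one>\<^bsub>L2\<^esub>"
    using assms(1) by (auto simp: rays_plus_def)
  have "eventually (\<lambda>N. r \<le> H (\<gamma> N)) sequentially"
    using assms(1) by (simp add: rays_plus_def filterlim_at_top)
  moreover have "eventually (\<lambda>N. p |\<in>| lit (\<gamma> N)) sequentially"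
    using assms(3) by (simp add: limit_lit_def)
  ultimately show "eventually (\<lambda>N. horo_embed (\<gamma> N) x = real_of_int (H x)) sequentially"
  proof eventually_elim
    case (elim N)
    \<comment> \<open>Lamp \<open>p\<close> is lit in \<open>\<gamma> N\<close> but neither in
      \<open>x\<close> nor in the identity. Any interval admissible for either pair thus reaches
      from \<open>p\<close> to \<open>H (\<gamma> N)\<close> and covers all of
      \<open>[l, r]\<close>, where \<open>x\<close> and the identity can differ.\<close>
    have "connects l' r' (\<gamma> N) x \<longleftrightarrow> connects l' r' (\<gamma> N) \<one>\<^bsub>L2\<^esub>" for l' r'
      using elim assms(2,4) unfolding connects_def spans_def one_L2 by (simp, smt (verit))
    from d_diff_eq[OF this] show ?case
      using elim assms(2) by (simp add: horo_embed_def one_L2 spans_def)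
  qed
qed

lemma busemann_eq_uminus_H:
  assumes "\<gamma> \<in> rays_minus" "spans l r x" "p \<in> limit_lit \<gamma>" "r < p"
  shows "busemann \<gamma> x = - real_of_int (H x)"
proof (rule busemann_eqI)
  show "geodesic_ray \<gamma>" "\<gamma> 0 = \<one>\<^bsub>L2\<^esub>"
    using assms(1) by (auto simp: rays_minus_def)
  have "eventually (\<lambda>N. H (\<gamma> N) \<le> l) sequentially"
    using assms(1) by (simp add: rays_minus_def filterlim_at_bot)
  moreover have "eventually (\<lambda>N. p |\<in>| lit (\<gamma> N)) sequentially"
    using assms(3) by (simp add: limit_lit_def)
  ultimately show "eventually (\<lambda>N. horo_embed (\<gamma> N) x = - real_of_int (H x)) sequentially"
  proof eventually_elim
    case (elim N)
    \<comment> \<open>Mirror image: admissible intervals reach from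
      \<open>H (\<gamma> N) \<le> l\<close> beyond \<open>p > r\<close>.\<close>
    have "connects l' r' (\<gamma> N) x \<longleftrightarrow> connects l' r' (\<gamma> N) \<one>\<^bsub>L2\<^esub>" for l' r'
      using elim assms(2,4) unfolding connects_def spans_def one_L2 by (simp, smt (verit))
    from d_diff_eq[OF this] show ?case
      using elim assms(2) by (simp add: horo_embed_def one_L2 spans_def)
  qed
qed

text \<open>
  The next two lemmas do not rely on the extremum being attained: if \<open>limit_lit \<gamma>\<close> has no least
  element, the \<open>LEAST\<close> is junk, but then the set contains elements below any bound.
\<close>

lemma int_set_less_Least:
  fixes A :: "int set"
  assumes "A \<noteq> {}" "(LEAST p. p \<in> A) < c"
  shows "\<exists>p\<in>A. p < c"
proof (rule ccontr)
  assume "\<not> ?thesis"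
  then have c: "\<And>p. p \<in> A \<Longrightarrow> c \<le> p"
    by force
  obtain a where "a \<in> A"
    using assms(1) by blast
  \<comment> \<open>Offsets from the lower bound \<open>c\<close> are natural numbers, so a least
    one exists.\<close>
  define k where "k = (LEAST k. c + int k \<in> A)"
  have "c + int (nat (a - c)) \<in> A"
    using \<open>a \<in> A\<close> c by force
  then have k: "c + int k \<in> A"
    unfolding k_def by (rule LeastI)
  moreover have "c + int k \<le> p" if "p \<in> A" for p
  proof -
    have "k \<le> nat (p - c)"
      unfolding k_def using that c[OF that] by (intro Least_le) simp
    then show ?thesis
      using c[OF that] by linarith
  qed
  ultimately have "(LEAST p. p \<in> A) = c + int k"
    by (rule Least_equality)
  with assms(2) show False
    by linarith
qed

lemma int_set_greater_Greatest:
  fixes A :: "int set"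
  assumes "A \<noteq> {}" "c < (GREATEST p. p \<in> A)"
  shows "\<exists>p\<in>A. c < p"
proof (rule ccontr)
  assume "\<not> ?thesis"
  then have c: "\<And>p. p \<in> A \<Longrightarrow> p \<le> c"
    by force
  obtain a where "a \<in> A"
    using assms(1) by blast
  define k where "k = (LEAST k. c - int k \<in> A)"
  have "c - int (nat (c - a)) \<in> A"
    using \<open>a \<in> A\<close> c by force
  then have k: "c - int k \<in> A"
    unfolding k_def by (rule LeastI)
  moreover have "p \<le> c - int k" if "p \<in> A" for p
  proof -
    have "k \<le> nat (c - p)"
      unfolding k_def using that c[OF that] by (intro Least_le) simp
    then show ?thesis
      using c[OF that] by linarith
  qed
  ultimately have "(GREATEST p. p \<in> A) = c - int k"
    by (rule Greatest_equality)
  with assms(2) show False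
    by linarith
qed

text \<open>The default \<infinity> for an empty configuration violates the bound, so
  \<open>int_set_less_Least\<close> applies.\<close>

lemma limit_lit_below:
  assumes "min_lit \<gamma> < ereal (real_of_int c)"
  shows "\<exists>p\<in>limit_lit \<gamma>. p < c"
  using assms by (intro int_set_less_Least) (auto simp: min_lit_def split: if_splits)

lemma limit_lit_above:
  assumes "ereal (real_of_int c) < max_lit \<gamma>"
  shows "\<exists>p\<in>limit_lit \<gamma>. c < p"
  using assms by (intro int_set_greater_Greatest) (auto simp: max_lit_def split: if_splits)

lemma boundary_plus_rep: "\<xi> \<in> boundary_plus \<Longrightarrow> \<gamma> \<in> \<xi> \<Longrightarrow> \<gamma> \<in> rays_plus"
  by (auto simp: boundary_plus_def elim!: quotientE)

lemma boundary_minus_rep: "\<xi> \<in> boundary_minus \<Longrightarrow> \<gamma> \<in> \<xi> \<Longrightarrow> \<gamma> \<in> rays_minus"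
  by (auto simp: boundary_minus_def elim!: quotientE)

section \<open>Convergence to \<open>H\<close> and to \<open>- H\<close>\<close>

lemma busemann_plus_limit:
  assumes "\<And>n. \<gamma> n \<in> rays_plus" "(\<lambda>n. min_lit (\<gamma> n)) \<longlonglongrightarrow> - \<infinity>"
  shows "\<forall>n. busemann (\<gamma> n) \<in> horofunction_boundary"
    and "limitin (top_of_set horofunction_boundary)
      (\<lambda>n. busemann (\<gamma> n)) (\<lambda>x. real_of_int (H x)) sequentially"
proof -
  have mem: "busemann (\<gamma> n) \<in> horofunction_boundary" for n
    using assms(1)[of n] by (intro busemann_in_horofunction_boundary) (auto simp: rays_plus_def)
  then show "\<forall>n. busemann (\<gamma> n) \<in> horofunction_boundary"
    by blast
  show "limitin (top_of_set horofunction_boundary)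
      (\<lambda>n. busemann (\<gamma> n)) (\<lambda>x. real_of_int (H x)) sequentially"
  proof (rule limitin_horofunction_boundary[OF mem])
    fix x
    obtain l r where lr: "spans l r x"
      using spans_exists by blast
    \<comment> \<open>From such an \<open>n\<close> on, some lamp left of \<open>l\<close> is lit in
      the limit configuration, and the value at \<open>x\<close> is exactly
      \<open>H x\<close>.\<close>
    have "eventually (\<lambda>n. min_lit (\<gamma> n) < ereal (real_of_int l)) sequentially"
      by (rule order_tendstoD(2)[OF assms(2)]) simp
    then show "eventually (\<lambda>n. busemann (\<gamma> n) x = real_of_int (H x)) sequentially"
      by eventually_elim (use limit_lit_below busemann_eq_H[OF assms(1) lr] in blast)
  next
    show "\<exists>x. real_of_int (H x) \<le> - real k" for k
      by (rule exI[of _ "Lampstand {||} (- int k)"]) simp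
  qed
qed

lemma busemann_minus_limit:
  assumes "\<And>n. \<gamma> n \<in> rays_minus" "(\<lambda>n. max_lit (\<gamma> n)) \<longlonglongrightarrow> \<infinity>"
  shows "\<forall>n. busemann (\<gamma> n) \<in> horofunction_boundary"
    and "limitin (top_of_set horofunction_boundary)
      (\<lambda>n. busemann (\<gamma> n)) (\<lambda>x. - real_of_int (H x)) sequentially"
proof -
  have mem: "busemann (\<gamma> n) \<in> horofunction_boundary" for n
    using assms(1)[of n] by (intro busemann_in_horofunction_boundary) (auto simp: rays_minus_def)
  then show "\<forall>n. busemann (\<gamma> n) \<in> horofunction_boundary"
    by blast
  show "limitin (top_of_set horofunction_boundary)
      (\<lambda>n. busemann (\<gamma> n)) (\<lambda>x. - real_of_int (H x)) sequentially"
  proof (rule limitin_horofunction_boundary[OF mem])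
    fix x
    obtain l r where lr: "spans l r x"
      using spans_exists by blast
    have "eventually (\<lambda>n. ereal (real_of_int r) < max_lit (\<gamma> n)) sequentially"
      by (rule order_tendstoD(1)[OF assms(2)]) simp
    then show "eventually (\<lambda>n. busemann (\<gamma> n) x = - real_of_int (H x)) sequentially"
      by eventually_elim (use limit_lit_above busemann_eq_uminus_H[OF assms(1) lr] in blast)
  next
    show "\<exists>x. - real_of_int (H x) \<le> - real k" for k
      by (rule exI[of _ "Lampstand {||} (int k)"]) simp
  qed
qed

theorem mainTheorem6:
  "(\<forall>(\<xi> :: nat \<Rightarrow> (nat \<Rightarrow> lampstand) set) (\<gamma> :: nat \<Rightarrow> nat \<Rightarrow> lampstand).
      (\<forall>n. \<xi> n \<in> boundary_plus \<and> \<gamma> n \<in> \<xi> n) \<longrightarrow>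
      (\<lambda>n. min_lit (\<gamma> n)) \<longlonglongrightarrow> - \<infinity> \<longrightarrow>
      (\<forall>n. busemann (\<gamma> n) \<in> horofunction_boundary) \<and>
      limitin (top_of_set horofunction_boundary)
        (\<lambda>n. busemann (\<gamma> n)) (\<lambda>x. real_of_int (H x)) sequentially) \<and>
   (\<forall>(\<xi> :: nat \<Rightarrow> (nat \<Rightarrow> lampstand) set) (\<gamma> :: nat \<Rightarrow> nat \<Rightarrow> lampstand).
      (\<forall>n. \<xi> n \<in> boundary_minus \<and> \<gamma> n \<in> \<xi> n) \<longrightarrow>
      (\<lambda>n. max_lit (\<gamma> n)) \<longlonglongrightarrow> \<infinity> \<longrightarrow>
      (\<forall>n. busemann (\<gamma> n) \<in> horofunction_boundary) \<and>
      limitin (top_of_set horofunction_boundary)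
        (\<lambda>n. busemann (\<gamma> n)) (\<lambda>x. - real_of_int (H x)) sequentially)"
proof (intro conjI allI impI)
  fix \<xi> :: "nat \<Rightarrow> (nat \<Rightarrow> lampstand) set" and \<gamma> :: "nat \<Rightarrow> nat \<Rightarrow> lampstand"
  assume "\<forall>n. \<xi> n \<in> boundary_plus \<and> \<gamma> n \<in> \<xi> n"
  then have rays: "\<And>n. \<gamma> n \<in> rays_plus"
    using boundary_plus_rep by blast
  assume lim: "(\<lambda>n. min_lit (\<gamma> n)) \<longlonglongrightarrow> - \<infinity>"
  show "busemann (\<gamma> n) \<in> horofunction_boundary" for n
    using busemann_plus_limit(1)[OF rays lim] by blast
  show "limitin (top_of_set horofunction_boundary)
      (\<lambda>n. busemann (\<gamma> n)) (\<lambda>x. real_of_int (H x)) sequentially"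
    by (rule busemann_plus_limit(2)[OF rays lim])
next
  fix \<xi> :: "nat \<Rightarrow> (nat \<Rightarrow> lampstand) set" and \<gamma> :: "nat \<Rightarrow> nat \<Rightarrow> lampstand"
  assume "\<forall>n. \<xi> n \<in> boundary_minus \<and> \<gamma> n \<in> \<xi> n"
  then have rays: "\<And>n. \<gamma> n \<in> rays_minus"
    using boundary_minus_rep by blast
  assume lim: "(\<lambda>n. max_lit (\<gamma> n)) \<longlonglongrightarrow> \<infinity>"
  show "busemann (\<gamma> n) \<in> horofunction_boundary" for n
    using busemann_minus_limit(1)[OF rays lim] by blast
  show "limitin (top_of_set horofunction_boundary)
      (\<lambda>n. busemann (\<gamma> n)) (\<lambda>x. - real_of_int (H x)) sequentially"
    by (rule busemann_minus_limit(2)[OF rays lim])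
qed

end
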